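(* For each $m=0,1,\ldots$, the functional iteration scheme defined by $F_m$ is stable if and only if the following two conditions are satisfied for all $\ell=1,\ldots,N_f$: $$\theta_\ell\in\mathcal{S}_m\equiv\bigcup_{k=0,\ldots,m}\left(\frac{2m+4k+1}{2(m+1)}\pi,\ \frac{2m+4k+3}{2(m+1)}\pi\right)\cap\left[\left(\frac{\pi}{2},\frac{3\pi}{2}\right)\ \mathrm{mod}\ 2\pi\right]$$ and $$0<H<H^{\max}_\ell\equiv\frac{\varepsilon}{|\lambda_\ell|}\left[2\cos((m+1)(\theta_\ell-\pi))\right]^{1/(m+1)}.$$ In particular, if $\lambda_1,\ldots,\lambda_{N_f}$ are real, then the functional iteration is stable for all $H>0$ satisfying $$H<H^{\max}\equiv2^{1/(m+1)}\frac{\varepsilon}{\|D_yg\|_2}.$$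
   Context: Setting. Consider the fast--slow system $x'=f(x,y,\varepsilon)$, $\varepsilon y'=g(x,y,\varepsilon)$, with $x\in\mathbf{R}^{N_s}$, $y\in\mathbf{R}^{N_f}$, $'=d/dt$, $0<\varepsilon\ll1$, where $f,g$ are smooth. On $\{z=(x,y): g(z,0)=0\}$ one assumes $\det (D_yg)(z,0)\neq0$. The system has an $N_s$-dimensional, slow, invariant, normally attracting manifold $\mathcal{L}=\{(x,h(x)): x\in K\}$, $K\subset\mathbf{R}^{N_s}$, where $h$ satisfies $g(x,h(x),\varepsilon)-\varepsilon Dh(x)f(x,h(x),\varepsilon)=0$ and $h=\sum_{i\ge0}\varepsilon^ih_{[i]}$; in particular $g(x,h_{[0]}(x),0)=0$. Fix $x_0\in K$. The step size $H>0$ satisfies $H=\mathcal{O}(\varepsilon)$. For $m=0,1,\ldots$ the map $F_m:\mathbf{R}^{N_f}\to\mathbf{R}^{N_f}$ is $$F_m(y)=y-(-H)^{m+1}\left(\frac{d^{m+1}y}{dt^{m+1}}\right)(x_0,y),$$ where the time derivative is evaluated at $(x_0,y)$ along solutions of the system; the functional iteration scheme is $y^{(r+1)}=F_m(y^{(r)})$. $F_m$ has an isolated fixed point $y=h_m(x_0)$, which is the solution of $\left(\frac{d^{m+1}y}{dt^{m+1}}\right)(x_0,y)=0$ with $h_m(x_0)=h_{[0]}(x_0)+\mathcal{O}(\varepsilon)$. Spectrum. Let $\lambda_\ell=\lambda_{\ell,R}+i\lambda_{\ell,I}=|\lambda_\ell|e^{i\theta_\ell}$, $\ell=1,\ldots,N_f$,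 be the eigenvalues of $(D_yg)_0=(D_yg)(x_0,h_{[0]}(x_0),0)$. Normal attractivity means $\lambda_{\ell,R}<0$, i.e. $\pi/2<\theta_\ell<3\pi/2$, for all $\ell$. In the last display $\|D_yg\|_2$ is the matrix 2-norm of $(D_yg)_0$. Stability. The scheme is called stable if the fixed point $h_m(x_0)$ is exponentially attracting, i.e. the spectrum of the Jacobian $(DF_m)(h_m(x_0))$ is contained in the open unit disk of $\mathbf{C}$. This is understood to leading order in $\varepsilon$: the Jacobian is replaced by its leading-order part as $\varepsilon\to0$ with $H/\varepsilon$ fixed. *)

theory Defs
  imports "HOL-Analysis.Analysis" "HOL-Library.Landau_Symbols"
begin

text \<open>Continuous differentiability of order k on an open set: all iterated directional
  derivatives up to order k exist and are continuous (all domains used are finite-dimensional).\<close>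

primrec Ck_on :: "nat \<Rightarrow> 'a::real_normed_vector set \<Rightarrow> ('a \<Rightarrow> 'b::real_normed_vector) \<Rightarrow> bool" where
  "Ck_on 0 S u \<longleftrightarrow> continuous_on S u"
| "Ck_on (Suc k) S u \<longleftrightarrow>
     (\<forall>p\<in>S. u differentiable (at p)) \<and>
     (\<forall>v. Ck_on k S (\<lambda>p. frechet_derivative u (at p) v))"

definition smooth_on :: "'a::real_normed_vector set \<Rightarrow> ('a \<Rightarrow> 'b::real_normed_vector) \<Rightarrow> bool" where
  "smooth_on S u \<longleftrightarrow> (\<forall>k. Ck_on k S u)"

definition spectrum :: "real^'n^'n \<Rightarrow> complex set" where
  "spectrum A = {\<mu>. \<exists>v. v \<noteq> 0 \<and> map_matrix complex_of_real A *v v = \<mu> *s v}"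

text \<open>lam enumerates the eigenvalues with algebraic multiplicity: it splits the
  characteristic polynomial.\<close>

definition eigenvalue_enum :: "real^'n^'n \<Rightarrow> ('n \<Rightarrow> complex) \<Rightarrow> bool" where
  "eigenvalue_enum A lam \<longleftrightarrow>
     (\<forall>z. det (mat z - map_matrix complex_of_real A) = (\<Prod>l\<in>UNIV. z - lam l))"

type_synonym ('s, 'f, 'c) fs_field = "real^'s \<Rightarrow> real^'f \<Rightarrow> real \<Rightarrow> real^'c"

definition D\<^sub>y :: "('s, 'f, 'f) fs_field \<Rightarrow> real^'s \<Rightarrow> real^'f \<Rightarrow> real \<Rightarrow> real^'f^'f" where
  "D\<^sub>y g x y \<epsilon> = jacobian (\<lambda>v. g x v \<epsilon>) (at y)"

text \<open>The pair (X, Y) solves x' = f(x,y,eps), eps y' = g(x,y,eps) at all times in the open set T.\<close>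

definition solves ::
  "('s, 'f, 's) fs_field \<Rightarrow> ('s, 'f, 'f) fs_field \<Rightarrow> real \<Rightarrow> real set
     \<Rightarrow> (real \<Rightarrow> real^'s) \<Rightarrow> (real \<Rightarrow> real^'f) \<Rightarrow> bool" where
  "solves f g \<epsilon> T X Y \<longleftrightarrow>
     (\<forall>t\<in>T. \<exists>Y'. (X has_vector_derivative f (X t) (Y t) \<epsilon>) (at t) \<and>
                 (Y has_vector_derivative Y') (at t) \<and> \<epsilon> *\<^sub>R Y' = g (X t) (Y t) \<epsilon>)"

text \<open>The n-th time derivative of y at the state (x, y), taken along the solution through
  that state. For smooth f and g the local solution exists and is locally unique, so
  the description below is proper.\<close>

definition time_deriv ::
  "('s, 'f, 's) fs_field \<Rightarrow> ('s, 'f, 'f) fs_field \<Rightarrow> real \<Rightarrow> nat \<Rightarrow> real^'s \<Rightarrow> real^'f \<Rightarrow> real^'f" where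
  "time_deriv f g \<epsilon> n x y =
     (THE v. \<exists>\<delta>>0. \<exists>X Y. solves f g \<epsilon> {-\<delta><..<\<delta>} X Y \<and> X 0 = x \<and> Y 0 = y \<and>
        v = ((\<lambda>u t. vector_derivative u (at t)) ^^ n) Y 0)"

definition iter_map ::
  "('s, 'f, 's) fs_field \<Rightarrow> ('s, 'f, 'f) fs_field \<Rightarrow> real^'s \<Rightarrow> nat \<Rightarrow> real \<Rightarrow> real
     \<Rightarrow> real^'f \<Rightarrow> real^'f" where
  "iter_map f g x0 m \<epsilon> H y = y - (- H) ^ (m + 1) *\<^sub>R time_deriv f g \<epsilon> (m + 1) x0 y"

text \<open>Here h eps is the graph function at parameter eps, and hs i is the coefficient of eps^i
  in its expansion, understood asymptotically as eps tends to 0 from above. The derivative of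
  h eps is taken within K, so that K may be closed.\<close>

definition slow_manifold ::
  "('s, 'f, 's) fs_field \<Rightarrow> ('s, 'f, 'f) fs_field \<Rightarrow> real \<Rightarrow> (real^'s) set
     \<Rightarrow> (real \<Rightarrow> real^'s \<Rightarrow> real^'f) \<Rightarrow> (nat \<Rightarrow> real^'s \<Rightarrow> real^'f) \<Rightarrow> bool" where
  "slow_manifold f g \<epsilon>0 K h hs \<longleftrightarrow>
     (\<forall>\<epsilon>\<in>{0<..<\<epsilon>0}. \<forall>x\<in>K. \<exists>Dh. (h \<epsilon> has_derivative Dh) (at x within K) \<and>
        g x (h \<epsilon> x) \<epsilon> - \<epsilon> *\<^sub>R Dh (f x (h \<epsilon> x) \<epsilon>) = 0) \<and>
     (\<forall>x\<in>K. \<forall>n. (\<lambda>\<epsilon>. norm (h \<epsilon> x - (\<Sum>i\<le>n. \<epsilon> ^ i *\<^sub>R hs i x))) \<in> O[at_right 0](\<lambda>\<epsilon>. \<epsilon> ^ (n + 1))) \<and>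
     (\<forall>x\<in>K. g x (hs 0 x) 0 = 0) \<and>
     (\<forall>x\<in>K. \<forall>\<mu>\<in>spectrum (D\<^sub>y g x (hs 0 x) 0). Re \<mu> < 0)"

definition is_fixed_point_branch ::
  "('s, 'f, 's) fs_field \<Rightarrow> ('s, 'f, 'f) fs_field \<Rightarrow> real^'s \<Rightarrow> real^'f \<Rightarrow> nat
     \<Rightarrow> (real \<Rightarrow> real^'f) \<Rightarrow> bool" where
  "is_fixed_point_branch f g x0 y0 m hm \<longleftrightarrow>
     (\<forall>\<^sub>F \<epsilon> in at_right 0. time_deriv f g \<epsilon> (m + 1) x0 (hm \<epsilon>) = 0) \<and>
     (\<lambda>\<epsilon>. norm (hm \<epsilon> - y0)) \<in> O[at_right 0](\<lambda>\<epsilon>. \<epsilon>)"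

text \<open>Stability to leading order at parameters (eps, H): the Jacobian of the iteration map at its
  fixed point is replaced by its limit as e tends to 0 with the step-size ratio held at H / eps,
  and the spectrum of that limit must lie in the open unit disk.\<close>

definition scheme_stable ::
  "('s, 'f, 's) fs_field \<Rightarrow> ('s, 'f, 'f) fs_field \<Rightarrow> real^'s \<Rightarrow> nat \<Rightarrow> (real \<Rightarrow> real^'f)
     \<Rightarrow> real \<Rightarrow> real \<Rightarrow> bool" where
  "scheme_stable f g x0 m hm \<epsilon> H \<longleftrightarrow>
     (\<exists>J. ((\<lambda>e. jacobian (iter_map f g x0 m e (H / \<epsilon> * e)) (at (hm e))) \<longlongrightarrow> J) (at_right 0) \<and>
          spectrum J \<subseteq> ball 0 1)"

text \<open>Sets of angles are read modulo 2 pi; for large m some of the intervals in S_arcs lie beyond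
  3 pi / 2 and meet the arc (pi/2, 3 pi/2) only after translation.\<close>

definition mod_2pi :: "real set \<Rightarrow> real set" where
  "mod_2pi A = {\<theta>. \<exists>j::int. \<theta> + 2 * pi * of_int j \<in> A}"

definition S_arcs :: "nat \<Rightarrow> real set" where
  "S_arcs m = mod_2pi (\<Union>k\<in>{0..m}.
            {(2 * real m + 4 * real k + 1) / (2 * (real m + 1)) * pi <..<
             (2 * real m + 4 * real k + 3) / (2 * (real m + 1)) * pi})
         \<inter> mod_2pi {pi / 2 <..< 3 * pi / 2}"

definition H_max :: "nat \<Rightarrow> real \<Rightarrow> complex \<Rightarrow> real \<Rightarrow> real" where
  "H_max m \<epsilon> \<mu> \<theta> = \<epsilon> / cmod \<mu> * root (m + 1) (2 * cos ((real m + 1) * (\<theta> - pi)))"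

end

theory Submission
  imports Defs "HOL-Computational_Algebra.Fundamental_Theorem_Algebra"
begin

text \<open>
  Why the theorem holds. Treat \<open>\<epsilon>\<close> as a third state variable \<open>e\<close> that does not move, and
  measure time in units of \<open>\<epsilon>\<close>. The system becomes the flow of the smooth field
  \<open>V (x, y, e) = (e f, g, 0)\<close>, and along solutions of the original system \<open>\<epsilon>\<^sup>n y\<^sup>(\<^sup>n\<^sup>)\<close> is the \<open>n\<close>-th Lie derivative \<open>w\<^sub>n\<close> of the coordinate \<open>y\<close> along \<open>V\<close>. In this
  form the limit is no longer singular: \<open>w\<^sub>n\<close> is smooth up to and across \<open>e = 0\<close>, and with \<open>H = c e\<close>
  the iteration map is exactly \<open>y - (-c)\<^sup>m\<^sup>+\<^sup>1 w\<^sub>m\<^sub>+\<^sub>1 (x0, y, e)\<close> (\<open>iter_map_eq\<close>). Its Jacobian therefore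
  converges to the one at the point \<open>(x0, h0, 0)\<close>, where \<open>h0\<close> is the leading term of the fixed point.

  At that point \<open>V\<close> vanishes. Differentiating \<open>w\<^sub>n\<^sub>+\<^sub>1 = Dw\<^sub>n V\<close> there leaves only \<open>Dw\<^sub>n DV\<close>, and on
  fast directions \<open>DV\<close> acts as \<open>A = D\<^sub>y g\<close>; hence \<open>D\<^sub>y w\<^sub>n = A\<^sup>n\<close> and the leading-order Jacobian is
  \<open>1 - (-c A)\<^sup>m\<^sup>+\<^sup>1\<close> (\<open>jacobian_iter_map_tendsto\<close>). By spectral mapping (\<open>spectrum_one_minus_power\<close>) its
  eigenvalues are \<open>1 - (-c \<lambda>)\<^sup>m\<^sup>+\<^sup>1\<close> with \<open>\<lambda>\<close> an eigenvalue of \<open>A\<close>.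

  Write \<open>-c \<lambda> = \<rho> cis (\<theta> - \<pi>)\<close> and \<open>\<phi> = (m + 1) (\<theta> - \<pi>)\<close>. The point \<open>1 - \<rho>\<^sup>m\<^sup>+\<^sup>1 cis \<phi>\<close> lies in
  the open unit disk iff \<open>\<rho>\<^sup>m\<^sup>+\<^sup>1 < 2 cos \<phi>\<close>, that is, iff \<open>cos \<phi> > 0\<close> and \<open>\<rho>\<close> is below the
  \<open>(m + 1)\<close>-st root of \<open>2 cos \<phi>\<close>. The first condition is membership in the arcs
  (\<open>mem_S_arcs_iff\<close>), the second is the bound on the step size. For a real spectrum every angle is
  \<open>\<pi>\<close>, the cosine is 1, and \<open>\<bar>\<lambda>\<bar>\<close> is at most the operator norm.

  The time derivatives are defined through a solution of the system, so one has to exist; this is the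
  Picard--Lindeloef theorem (\<open>local_solution_exists\<close>). Uniqueness of solutions is replaced by the chain
  rule, which gives every solution through a state the same derivatives there
  (\<open>time_derivs_along_solution\<close>).
\<close>

section \<open>Calculus of smooth functions and Lie derivatives\<close>

lemma Ck_on_cong:
  assumes "open S" "\<And>p. p \<in> S \<Longrightarrow> u p = v p" "Ck_on k S u"
  shows "Ck_on k S v"
  using assms(2,3)
proof (induction k arbitrary: u v)
  case 0
  then show ?case using continuous_on_cong[of S S u v] by simp
next
  case (Suc k)
  have diff: "u differentiable at p" if "p \<in> S" for p
    using Suc.prems(2) that by simp
  have same: "frechet_derivative u (at p) = frechet_derivative v (at p)" if "p \<in> S" for p
    using frechet_derivative_transform_within_open[OF diff[OF that] assms(1) that Suc.prems(1)] .
  have "v differentiable at p" if "p \<in> S" for p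
    using diff[OF that] has_derivative_transform_within_open[OF _ assms(1) that, of u _ UNIV v]
      Suc.prems(1) by (auto simp: differentiable_def)
  moreover have "Ck_on k S (\<lambda>p. frechet_derivative v (at p) d)" for d
    using Suc.IH[of "\<lambda>p. frechet_derivative u (at p) d"] Suc.prems(2) same by auto
  ultimately show ?case by simp
qed

lemma Ck_on_SucI:
  assumes "open S" "\<And>p. p \<in> S \<Longrightarrow> (u has_derivative u' p) (at p)"
    "\<And>d. Ck_on k S (\<lambda>p. u' p d)"
  shows "Ck_on (Suc k) S u"
proof -
  have "u' p = frechet_derivative u (at p)" if "p \<in> S" for p
    by (rule frechet_derivative_at[OF assms(2)[OF that]])
  then have "Ck_on k S (\<lambda>p. frechet_derivative u (at p) d)" for d
    by (intro Ck_on_cong[OF assms(1) _ assms(3)[of d]]) simp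
  then show ?thesis
    using assms(2) by (auto simp: differentiable_def)
qed

lemma Ck_on_SucD:
  assumes "Ck_on (Suc k) S u"
  shows "p \<in> S \<Longrightarrow> (u has_derivative frechet_derivative u (at p)) (at p)"
    and "Ck_on k S (\<lambda>p. frechet_derivative u (at p) d)"
  using assms frechet_derivative_works by auto

lemma Ck_on_Suc_imp: "Ck_on (Suc k) S u \<Longrightarrow> Ck_on k S u"
proof (induction k arbitrary: u)
  case 0
  then have "u differentiable_on S"
    by (simp add: differentiable_on_def differentiable_at_withinI)
  then show ?case by (simp add: differentiable_imp_continuous_on)
next
  case (Suc k)
  from Suc.prems have diff: "\<forall>p\<in>S. u differentiable (at p)"
    and "\<And>d. Ck_on (Suc k) S (\<lambda>p. frechet_derivative u (at p) d)"
    unfolding Ck_on.simps(2)[of "Suc k"] by blast+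
  from Suc.IH[OF this(2)] diff show ?case by simp
qed

lemma Ck_on_const: "open S \<Longrightarrow> Ck_on k S (\<lambda>_. c)"
  by (induction k arbitrary: c) auto

lemma Ck_on_bounded_linear:
  assumes "open S" "bounded_linear T"
  shows "Ck_on k S T"
proof (cases k)
  case 0
  then show ?thesis using assms(2) by (simp add: linear_continuous_on)
next
  case (Suc j)
  then show ?thesis
    using Ck_on_SucI[OF assms(1) bounded_linear_imp_has_derivative[OF assms(2)]
        Ck_on_const[OF assms(1)]] by simp
qed

lemma Ck_on_linear_compose:
  assumes "open S" "bounded_linear T" "Ck_on k S u"
  shows "Ck_on k S (\<lambda>p. T (u p))"
  using assms(3)
proof (induction k arbitrary: u)
  case 0
  then show ?case using bounded_linear.continuous_on[OF assms(2)] by simp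
next
  case (Suc k)
  note u = Ck_on_SucD[OF Suc.prems]
  show ?case
    by (rule Ck_on_SucI[OF assms(1) bounded_linear.has_derivative[OF assms(2) u(1)] Suc.IH[OF u(2)]])
qed

lemma Ck_on_add:
  assumes "open S" "Ck_on k S u" "Ck_on k S v"
  shows "Ck_on k S (\<lambda>p. u p + v p)"
  using assms(2,3)
proof (induction k arbitrary: u v)
  case 0
  then show ?case by (simp add: continuous_on_add)
next
  case (Suc k)
  note u = Ck_on_SucD[OF Suc.prems(1)] and v = Ck_on_SucD[OF Suc.prems(2)]
  show ?case
    by (rule Ck_on_SucI[OF assms(1) has_derivative_add[OF u(1) v(1)] Suc.IH[OF u(2) v(2)]])
qed

lemma Ck_on_sum:
  assumes "open S" "finite I" "\<And>i. i \<in> I \<Longrightarrow> Ck_on k S (u i)"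
  shows "Ck_on k S (\<lambda>p. \<Sum>i\<in>I. u i p)"
  using assms(2,3)
  by (induction I rule: finite_induct) (simp_all add: Ck_on_const Ck_on_add assms(1))

lemma Ck_on_scaleR:
  assumes "open S" "Ck_on k S a" "Ck_on k S u"
  shows "Ck_on k S (\<lambda>p. a p *\<^sub>R u p)"
  using assms(2,3)
proof (induction k arbitrary: a u)
  case 0
  then show ?case by (simp add: continuous_on_scaleR)
next
  case (Suc k)
  note a = Ck_on_SucD[OF Suc.prems(1)] and u = Ck_on_SucD[OF Suc.prems(2)]
  show ?case
  proof (rule Ck_on_SucI[OF assms(1)])
    show "((\<lambda>p. a p *\<^sub>R u p) has_derivative
        (\<lambda>d. a p *\<^sub>R frechet_derivative u (at p) d + frechet_derivative a (at p) d *\<^sub>R u p)) (at p)"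
      if "p \<in> S" for p
      using has_derivative_scaleR[OF a(1)[OF that] u(1)[OF that]] .
    show "Ck_on k S (\<lambda>p. a p *\<^sub>R frechet_derivative u (at p) d
        + frechet_derivative a (at p) d *\<^sub>R u p)" for d
      by (intro Ck_on_add assms(1) Suc.IH a(2) u(2) Ck_on_Suc_imp[OF Suc.prems(1)]
          Ck_on_Suc_imp[OF Suc.prems(2)])
  qed
qed

definition lie_deriv ::
  "('a::euclidean_space \<Rightarrow> 'a) \<Rightarrow> ('a \<Rightarrow> 'b::real_normed_vector) \<Rightarrow> 'a \<Rightarrow> 'b" where
  "lie_deriv V u p = frechet_derivative u (at p) (V p)"

lemma smooth_onD:
  assumes "smooth_on S u"
  shows "p \<in> S \<Longrightarrow> (u has_derivative frechet_derivative u (at p)) (at p)"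
    and "smooth_on S (\<lambda>p. frechet_derivative u (at p) d)"
    and "continuous_on S u"
proof -
  have u: "Ck_on k S u" for k using assms by (simp add: smooth_on_def)
  show "p \<in> S \<Longrightarrow> (u has_derivative frechet_derivative u (at p)) (at p)"
    using Ck_on_SucD(1)[OF u] .
  show "smooth_on S (\<lambda>p. frechet_derivative u (at p) d)"
    using Ck_on_SucD(2)[OF u] by (simp add: smooth_on_def)
  show "continuous_on S u" using u[of 0] by simp
qed

lemma lie_deriv_expand:
  assumes "smooth_on S u" "p \<in> S"
  shows "lie_deriv V u p = (\<Sum>b\<in>Basis. (V p \<bullet> b) *\<^sub>R frechet_derivative u (at p) b)"
proof -
  have lin: "linear (frechet_derivative u (at p))"
    using smooth_onD(1)[OF assms] has_derivative_linear by blast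
  have "frechet_derivative u (at p) (V p)
      = frechet_derivative u (at p) (\<Sum>b\<in>Basis. (V p \<bullet> b) *\<^sub>R b)"
    by (simp add: euclidean_representation)
  then show ?thesis
    by (simp only: lie_deriv_def linear_sum[OF lin] linear_scale[OF lin])
qed

text \<open>The direction \<open>V p\<close> varies with \<open>p\<close>, while smoothness speaks of fixed directions only; the
  expansion over a basis reduces the former to the latter.\<close>
lemma smooth_on_lie_deriv:
  assumes S: "open S" and V: "smooth_on S V" and u: "smooth_on S u"
  shows "smooth_on S (lie_deriv V u)"
proof -
  have comp: "Ck_on k S (\<lambda>p. V p \<bullet> b)" and du: "Ck_on k S (\<lambda>p. frechet_derivative u (at p) b)"
    for k b
    using Ck_on_linear_compose[OF S bounded_linear_inner_left] V smooth_onD(2)[OF u]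
    unfolding smooth_on_def by blast+
  have expand: "Ck_on k S (\<lambda>p. \<Sum>b\<in>Basis. (V p \<bullet> b) *\<^sub>R frechet_derivative u (at p) b)" for k
    by (rule Ck_on_sum[OF S finite_Basis Ck_on_scaleR[OF S comp du]])
  have "Ck_on k S (lie_deriv V u)" for k
    by (rule Ck_on_cong[OF S _ expand]) (simp add: lie_deriv_expand[OF u])
  then show ?thesis by (simp add: smooth_on_def)
qed

text \<open>Differentiating the product of derivative and field leaves only the term in which the field
  is differentiated, because the field itself vanishes; the second derivatives drop out.\<close>
lemma deriv_lie_deriv_at_zero:
  assumes S: "open S" "p \<in> S" and V: "smooth_on S V" and u: "smooth_on S u" and zero: "V p = 0"
  shows "frechet_derivative (lie_deriv V u) (at p) d
    = frechet_derivative u (at p) (frechet_derivative V (at p) d)"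
proof -
  let ?D = "\<lambda>u. frechet_derivative u (at p)"
  have lin: "linear (?D u)"
    using smooth_onD(1)[OF u S(2)] has_derivative_linear by blast
  have "((\<lambda>q. \<Sum>b\<in>Basis. (V q \<bullet> b) *\<^sub>R frechet_derivative u (at q) b) has_derivative
      (\<lambda>d. \<Sum>b\<in>Basis. (V p \<bullet> b) *\<^sub>R ?D (\<lambda>q. frechet_derivative u (at q) b) d
         + (?D V d \<bullet> b) *\<^sub>R ?D u b)) (at p)"
    by (rule has_derivative_sum)
      (rule has_derivative_scaleR[OF has_derivative_inner_left[OF smooth_onD(1)[OF V S(2)]]
        smooth_onD(1)[OF smooth_onD(2)[OF u] S(2)]])
  then have "((\<lambda>q. \<Sum>b\<in>Basis. (V q \<bullet> b) *\<^sub>R frechet_derivative u (at q) b) has_derivative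
      (\<lambda>d. \<Sum>b\<in>Basis. (?D V d \<bullet> b) *\<^sub>R ?D u b)) (at p)"
    by (simp add: zero)
  then have "(lie_deriv V u has_derivative (\<lambda>d. \<Sum>b\<in>Basis. (?D V d \<bullet> b) *\<^sub>R ?D u b)) (at p)"
    by (rule has_derivative_transform_within_open[OF _ S]) (simp add: lie_deriv_expand[OF u])
  from frechet_derivative_at[OF this]
  have "?D (lie_deriv V u) d = (\<Sum>b\<in>Basis. (?D V d \<bullet> b) *\<^sub>R ?D u b)"
    by (rule fun_cong[OF sym])
  also have "\<dots> = ?D u (\<Sum>b\<in>Basis. (?D V d \<bullet> b) *\<^sub>R b)"
    by (simp only: linear_sum[OF lin] linear_scale[OF lin])
  finally show ?thesis by (simp add: euclidean_representation)
qed

text \<open>The partial derivatives are continuous, hence bounded on a compact ball; their bounds add up to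
  a bound on the operator norm, and the mean value inequality gives the Lipschitz constant.\<close>
lemma Ck_on_locally_lipschitz:
  fixes F :: "'a::euclidean_space \<Rightarrow> 'b::real_normed_vector"
  assumes S: "open S" "p0 \<in> S" and F: "Ck_on 1 S F"
  obtains r L where "0 < r" "cball p0 r \<subseteq> S" "L-lipschitz_on (cball p0 r) F"
proof -
  obtain r where r: "0 < r" "cball p0 r \<subseteq> S"
    using S open_contains_cball by blast
  let ?D = "\<lambda>p. frechet_derivative F (at p)"
  have cont: "continuous_on (cball p0 r) (\<lambda>p. ?D p b)" for b
    using F r(2) by (auto intro: continuous_on_subset)
  have der: "(F has_derivative ?D p) (at p)" if "p \<in> cball p0 r" for p
    using F r(2) that frechet_derivative_works[of F] by auto
  have "\<exists>B. \<forall>p\<in>cball p0 r. norm (?D p b) \<le> B" for b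
    using compact_imp_bounded[OF compact_continuous_image[OF cont compact_cball]]
    by (auto simp: bounded_iff)
  then obtain B where B: "\<And>b p. p \<in> cball p0 r \<Longrightarrow> norm (?D p b) \<le> B b"
    by metis
  have bound: "onorm (?D p) \<le> (\<Sum>b\<in>Basis. B b)" if p: "p \<in> cball p0 r" for p
  proof (rule onorm_le)
    fix v
    have lin: "linear (?D p)" using der[OF p] has_derivative_linear by blast
    have "?D p v = (\<Sum>b\<in>Basis. (v \<bullet> b) *\<^sub>R ?D p b)"
      using arg_cong[OF euclidean_representation[of v], of "?D p"]
      by (simp only: linear_sum[OF lin] linear_scale[OF lin])
    also have "norm \<dots> \<le> (\<Sum>b\<in>Basis. norm v * B b)"
      by (intro sum_norm_le) (auto intro!: mult_mono B[OF p] Basis_le_norm)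
    finally show "norm (?D p v) \<le> (\<Sum>b\<in>Basis. B b) * norm v"
      by (simp add: sum_distrib_left mult.commute)
  qed
  have "norm (F p - F q) \<le> (\<Sum>b\<in>Basis. B b) * norm (p - q)"
    if "p \<in> cball p0 r" "q \<in> cball p0 r" for p q
    using differentiable_bound[OF convex_cball has_derivative_at_withinI[OF der] bound that] .
  moreover have "0 \<le> (\<Sum>b\<in>Basis. B b)"
    using bound[of p0] r(1) onorm_pos_le[OF has_derivative_bounded_linear[OF der[of p0]]] by simp
  ultimately have "(\<Sum>b\<in>Basis. B b)-lipschitz_on (cball p0 r) F"
    by (intro lipschitz_onI) (auto simp: dist_norm)
  then show ?thesis by (rule that[OF r])
qed

section \<open>Local existence for ordinary differential equations\<close>

text \<open>Picard--Lindeloef by Banach's fixed point theorem. Since \<open>F\<close> is controlled on a ball only, it is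
  precomposed with the nearest-point projection onto that ball, which does not increase distances. The
  resulting field \<open>G\<close> is globally bounded and Lipschitz, so the integral operator is a contraction of
  the whole space of bounded continuous curves; for short times its fixed point stays inside the ball,
  where \<open>G = F\<close>.\<close>
lemma local_solution_exists:
  fixes F :: "'a::euclidean_space \<Rightarrow> 'a"
  assumes r: "0 < r" and lip: "L-lipschitz_on (cball z0 r) F"
  obtains \<delta> u where "0 < \<delta>" "u 0 = z0"
    "\<forall>t. \<bar>t\<bar> < \<delta> \<longrightarrow> (u has_vector_derivative F (u t)) (at t)"
proof -
  let ?B = "cball z0 r"
  define G where "G = F \<circ> closest_point ?B"
  have in_ball: "closest_point ?B z \<in> ?B" for z
    using closest_point_in_set[of ?B z] r by simp
  have L: "0 \<le> L" using lip lipschitz_on_nonneg by blast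
  have G_lip: "dist (G z) (G w) \<le> L * dist z w" for z w
  proof -
    have "dist (G z) (G w) \<le> L * dist (closest_point ?B z) (closest_point ?B w)"
      using lipschitz_onD[OF lip in_ball in_ball] by (simp add: G_def)
    also have "\<dots> \<le> L * dist z w"
      using L r by (intro mult_left_mono closest_point_lipschitz) auto
    finally show ?thesis .
  qed
  then have "L-lipschitz_on UNIV G" using L by (intro lipschitz_onI) auto
  then have G_cont: "continuous_on UNIV G"
    by (rule lipschitz_on_continuous_on)
  have "bounded (F ` ?B)"
    using compact_imp_bounded[OF compact_continuous_image[OF lipschitz_on_continuous_on[OF lip]]]
    by simp
  then obtain M where M: "0 < M" "\<And>z. norm (G z) \<le> M"
    using in_ball by (auto simp: bounded_pos G_def)
  \<comment> \<open>The first bound keeps curves in the ball, the second makes the operator contract by 1/2. The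
    factor 3 accounts for the integrals over two intervals, of lengths at most \<open>2 \<delta>\<close> and \<open>\<delta>\<close>, in \<open>P\<close>.\<close>
  define \<delta> where "\<delta> = min (r / (3 * M)) (1 / (6 * (L + 1)))"
  have \<delta>: "0 < \<delta>" "3 * \<delta> * M \<le> r" "3 * \<delta> * L \<le> 1 / 2"
  proof -
    show "0 < \<delta>" using r M(1) L by (simp add: \<delta>_def)
    have "3 * \<delta> * M \<le> 3 * (r / (3 * M)) * M"
      using M(1) by (intro mult_right_mono mult_left_mono) (auto simp: \<delta>_def)
    then show "3 * \<delta> * M \<le> r" using M(1) by simp
    have "3 * \<delta> * L \<le> 3 * (1 / (6 * (L + 1))) * L"
      using L by (intro mult_right_mono mult_left_mono) (auto simp: \<delta>_def)
    also have "\<dots> \<le> 1 / 2" using L by (simp add: field_simps)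
    finally show "3 * \<delta> * L \<le> 1 / 2" .
  qed
  \<comment> \<open>Clamping time extends curves on \<open>[-\<delta>, \<delta>]\<close> to bounded curves on the whole line.\<close>
  define cl where "cl t = max (-\<delta>) (min \<delta> t)" for t
  have cl: "cl t \<in> {-\<delta>..\<delta>}" for t using \<delta>(1) by (auto simp: cl_def)
  \<comment> \<open>\<open>P v t\<close> is the integral of \<open>v\<close> from 0 to \<open>t\<close>, for either sign of \<open>t\<close>.\<close>
  define P where "P v t = integral {-\<delta>..t} v - integral {-\<delta>..0} v" for v :: "real \<Rightarrow> 'a" and t
  have P_bound: "norm (P v t) \<le> 3 * \<delta> * C"
    if t: "t \<in> {-\<delta>..\<delta>}" and v: "continuous_on UNIV v" "\<And>s. norm (v s) \<le> C" for v t C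
  proof -
    have C: "0 \<le> C" using v(2)[of 0] norm_ge_zero order_trans by blast
    have "norm (integral {-\<delta>..t} v) \<le> C * (t - (-\<delta>))"
      using t v by (intro integral_bound continuous_on_subset[OF v(1)]) auto
    moreover have "norm (integral {-\<delta>..0} v) \<le> C * (0 - (-\<delta>))"
      using \<delta>(1) v by (intro integral_bound continuous_on_subset[OF v(1)]) auto
    moreover have "C * (t - (-\<delta>)) \<le> C * (2 * \<delta>)" using t C by (intro mult_left_mono) auto
    ultimately show ?thesis
      unfolding P_def using norm_triangle_ineq4[of "integral {-\<delta>..t} v" "integral {-\<delta>..0} v"]
      by (simp add: algebra_simps)
  qed
  have G_along: "continuous_on UNIV (\<lambda>t. G (apply_bcontfun u t))" for u :: "real \<Rightarrow>\<^sub>C 'a"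
    using continuous_on_compose2[OF G_cont continuous_on_apply_bcontfun] by auto
  define \<Phi> where "\<Phi> u = Bcontfun (\<lambda>t. z0 + P (\<lambda>s. G (apply_bcontfun u s)) (cl t))"
    for u :: "real \<Rightarrow>\<^sub>C 'a"
  have \<Phi>: "apply_bcontfun (\<Phi> u) t = z0 + P (\<lambda>s. G (apply_bcontfun u s)) (cl t)" for u t
  proof -
    let ?v = "\<lambda>s. G (apply_bcontfun u s)"
    have "?v integrable_on {-\<delta>..\<delta>}"
      by (intro integrable_continuous_real continuous_on_subset[OF G_along]) auto
    from indefinite_integral_continuous_1[OF this]
    have "continuous_on {-\<delta>..\<delta>} (\<lambda>t. z0 + P ?v t)"
      unfolding P_def by (intro continuous_intros)
    moreover have "continuous_on UNIV cl"
      unfolding cl_def by (intro continuous_intros)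
    ultimately have "continuous_on UNIV (\<lambda>t. z0 + P ?v (cl t))"
      using cl by (auto intro: continuous_on_compose2)
    moreover have "norm (z0 + P ?v (cl t)) \<le> norm z0 + 3 * \<delta> * M" for t
      using P_bound[OF cl G_along M(2)] norm_triangle_ineq[of z0 "P ?v (cl t)"]
      by (meson add_left_mono order_trans)
    ultimately have "(\<lambda>t. z0 + P ?v (cl t)) \<in> bcontfun"
      by (rule bcontfun_normI)
    then show ?thesis by (simp add: \<Phi>_def Bcontfun_inverse)
  qed
  have contraction: "dist (\<Phi> u) (\<Phi> w) \<le> 1 / 2 * dist u w" for u w
  proof (rule dist_bound)
    fix t
    let ?u = "\<lambda>s. G (apply_bcontfun u s)" and ?w = "\<lambda>s. G (apply_bcontfun w s)"
    have int: "?u integrable_on {-\<delta>..s}" "?w integrable_on {-\<delta>..s}" for s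
      by (auto intro!: integrable_continuous_real continuous_on_subset[OF G_along])
    have le: "norm (?u s - ?w s) \<le> L * dist u w" for s
      using G_lip[of "apply_bcontfun u s" "apply_bcontfun w s"] dist_bounded[of u s w]
        mult_left_mono[OF _ L] by (metis dist_norm order_trans)
    have "dist (apply_bcontfun (\<Phi> u) t) (apply_bcontfun (\<Phi> w) t)
        = norm (P (\<lambda>s. ?u s - ?w s) (cl t))"
      by (simp add: \<Phi> P_def dist_norm integral_diff[OF int] algebra_simps)
    also have "\<dots> \<le> 3 * \<delta> * (L * dist u w)"
      using le by (intro P_bound cl continuous_on_diff G_along)
    also have "\<dots> \<le> 1 / 2 * dist u w"
      using mult_right_mono[OF \<delta>(3) zero_le_dist[of u w]] by (simp add: mult.assoc)
    finally show "dist (apply_bcontfun (\<Phi> u) t) (apply_bcontfun (\<Phi> w) t) \<le> 1 / 2 * dist u w" .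
  qed
  obtain u where fixpoint: "\<Phi> u = u"
    using banach_fix_type[of "1/2" \<Phi>] contraction by auto
  define U where "U = apply_bcontfun u"
  have U: "U t = z0 + P (\<lambda>s. G (U s)) (cl t)" for t
    using \<Phi>[of u t] by (simp add: fixpoint U_def)
  have U_in: "U t \<in> ?B" for t
    using P_bound[OF cl G_along M(2), of u t] \<delta>(2) U[of t]
    by (simp add: U_def dist_norm)
  have U0: "U 0 = z0"
    using U[of 0] \<delta>(1) by (simp add: cl_def P_def)
  have "(U has_vector_derivative F (U t)) (at t)" if t: "\<bar>t\<bar> < \<delta>" for t
  proof -
    have "((\<lambda>t. integral {-\<delta>..t} (\<lambda>s. G (U s))) has_vector_derivative G (U t))
        (at t within {-\<delta>..\<delta>})"
      unfolding U_def using t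
      by (intro integral_has_vector_derivative continuous_on_subset[OF G_along]) auto
    moreover have "at t within {-\<delta>..\<delta>} = at t"
      using t by (intro at_within_interior) auto
    ultimately have "((\<lambda>t. z0 + P (\<lambda>s. G (U s)) t) has_vector_derivative G (U t)) (at t)"
      unfolding P_def by (auto intro!: derivative_eq_intros)
    moreover have "z0 + P (\<lambda>s. G (U s)) s = U s" if "s \<in> {-\<delta><..<\<delta>}" for s
    proof -
      have "cl s = s" using that by (simp add: cl_def)
      with U[of s] show ?thesis by metis
    qed
    moreover have "t \<in> {-\<delta><..<\<delta>}" using t by auto
    ultimately have "(U has_vector_derivative G (U t)) (at t)"
      using has_vector_derivative_transform_within_open[OF _ open_greaterThanLessThan] by blast
    moreover have "G (U t) = F (U t)"
      using closest_point_self[OF U_in[of t]] by (simp add: G_def)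
    ultimately show ?thesis by simp
  qed
  then show ?thesis using that[of \<delta> U] \<delta>(1) U0 by simp
qed

section \<open>Time derivatives of the fast variable\<close>

primrec mat_power :: "'a::semiring_1^'n^'n \<Rightarrow> nat \<Rightarrow> 'a^'n^'n" where
  "mat_power A 0 = mat 1"
| "mat_power A (Suc n) = mat_power A n ** A"

text \<open>The fast--slow system with time measured in units of \<open>\<epsilon>\<close> and the parameter added as a constant
  third state variable. In this form it is regular at \<open>e = 0\<close>.\<close>
definition fs_vector_field ::
  "('s, 'f, 's) fs_field \<Rightarrow> ('s, 'f, 'f) fs_field
     \<Rightarrow> (real^'s) \<times> (real^'f) \<times> real \<Rightarrow> (real^'s) \<times> (real^'f) \<times> real" where
  "fs_vector_field f g = (\<lambda>(x, y, e). (e *\<^sub>R f x y e, g x y e, 0))"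

text \<open>This is \<open>e\<^sup>n\<close> times the \<open>n\<close>-th time derivative of \<open>y\<close>, but given by a formula that also makes
  sense, and is smooth, for \<open>e = 0\<close>.\<close>
definition scaled_time_deriv ::
  "('s, 'f, 's) fs_field \<Rightarrow> ('s, 'f, 'f) fs_field \<Rightarrow> nat
     \<Rightarrow> (real^'s) \<times> (real^'f) \<times> real \<Rightarrow> real^'f" where
  "scaled_time_deriv f g n = (lie_deriv (fs_vector_field f g) ^^ n) (\<lambda>p. fst (snd p))"

abbreviation (input) parameter_slab :: "real \<Rightarrow> ((real^'s) \<times> (real^'f) \<times> real) set" where
  "parameter_slab \<epsilon>0 \<equiv> UNIV \<times> UNIV \<times> {-\<epsilon>0<..<\<epsilon>0}"

lemma open_slab: "open (parameter_slab \<epsilon>0)"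
  by (intro open_Times open_UNIV open_greaterThanLessThan)

context
  fixes f :: "('s::finite, 'f::finite, 's) fs_field" and g :: "('s, 'f, 'f) fs_field" and \<epsilon>0 :: real
  assumes f_smooth: "smooth_on (parameter_slab \<epsilon>0) (\<lambda>(x, y, e). f x y e)"
    and g_smooth: "smooth_on (parameter_slab \<epsilon>0) (\<lambda>(x, y, e). g x y e)"
begin

lemma smooth_fs_vector_field: "smooth_on (parameter_slab \<epsilon>0) (fs_vector_field f g)"
proof -
  let ?S = "parameter_slab \<epsilon>0 :: ((real^'s) \<times> (real^'f) \<times> real) set"
  have smooth: "Ck_on k ?S (\<lambda>p. (snd (snd p) *\<^sub>R (case p of (x, y, e) \<Rightarrow> f x y e), 0)
      + (0, (case p of (x, y, e) \<Rightarrow> g x y e), 0))" for k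
  proof (rule Ck_on_add[OF open_slab])
    have "Ck_on k ?S (\<lambda>p. snd (snd p) *\<^sub>R (case p of (x, y, e) \<Rightarrow> f x y e))"
    proof (rule Ck_on_scaleR[OF open_slab])
      show "Ck_on k ?S (\<lambda>p. snd (snd p))"
        by (rule Ck_on_bounded_linear[OF open_slab bounded_linear_snd_comp[OF bounded_linear_snd]])
      show "Ck_on k ?S (\<lambda>p. case p of (x, y, e) \<Rightarrow> f x y e)"
        using f_smooth unfolding smooth_on_def by blast
    qed
    then show "Ck_on k ?S (\<lambda>p. (snd (snd p) *\<^sub>R (case p of (x, y, e) \<Rightarrow> f x y e), 0))"
      by (rule Ck_on_linear_compose[OF open_slab, rotated])
        (intro bounded_linear_Pair bounded_linear_ident bounded_linear_zero)
    have "Ck_on k ?S (\<lambda>p. case p of (x, y, e) \<Rightarrow> g x y e)"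
      using g_smooth unfolding smooth_on_def by blast
    then show "Ck_on k ?S (\<lambda>p. (0, (case p of (x, y, e) \<Rightarrow> g x y e), 0))"
      by (rule Ck_on_linear_compose[OF open_slab, rotated])
        (intro bounded_linear_Pair bounded_linear_ident bounded_linear_zero)
  qed
  have field: "(\<lambda>p. (snd (snd p) *\<^sub>R (case p of (x, y, e) \<Rightarrow> f x y e), 0)
      + (0, (case p of (x, y, e) \<Rightarrow> g x y e), 0)) = fs_vector_field f g"
    by (auto simp: fs_vector_field_def fun_eq_iff)
  show ?thesis unfolding smooth_on_def field[symmetric] by (rule allI smooth)+
qed

lemma smooth_scaled_time_deriv: "smooth_on (parameter_slab \<epsilon>0) (scaled_time_deriv f g n)"
proof (induction n)
  case 0
  show ?case
    by (simp add: scaled_time_deriv_def smooth_on_def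
        Ck_on_bounded_linear[OF open_slab bounded_linear_fst_comp[OF bounded_linear_snd]])
next
  case (Suc n)
  show ?case
    using smooth_on_lie_deriv[OF open_slab smooth_fs_vector_field Suc.IH]
    by (simp add: scaled_time_deriv_def)
qed

text \<open>The extended state moves with velocity \<open>V / e\<close>, so by the chain rule each time derivative amounts
  to one Lie derivative and one factor \<open>1 / e\<close>.\<close>
lemma time_derivs_along_solution:
  assumes e: "0 < e" "e < \<epsilon>0" and T: "open T" and sol: "solves f g e T X Y" and t: "t \<in> T"
  shows "((\<lambda>u t. vector_derivative u (at t)) ^^ n) Y t
    = (1 / e ^ n) *\<^sub>R scaled_time_deriv f g n (X t, Y t, e)"
  using t
proof (induction n arbitrary: t)
  case 0
  show ?case by (simp add: scaled_time_deriv_def)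
next
  case (Suc n)
  let ?w = "scaled_time_deriv f g n" and ?V = "fs_vector_field f g"
  let ?Z = "\<lambda>t. (X t, Y t, e)"
  have Z_in: "?Z t \<in> parameter_slab \<epsilon>0" using e by auto
  note D = smooth_onD(1)[OF smooth_scaled_time_deriv[of n] Z_in]
  obtain Y' where X: "(X has_vector_derivative f (X t) (Y t) e) (at t)"
    and Y: "(Y has_vector_derivative Y') (at t)" "e *\<^sub>R Y' = g (X t) (Y t) e"
    using sol Suc.prems unfolding solves_def by blast
  have "Y' = (1 / e) *\<^sub>R g (X t) (Y t) e"
    using e by (simp add: Y(2)[symmetric])
  then have "(f (X t) (Y t) e, Y', 0) = (1 / e) *\<^sub>R ?V (?Z t)"
    using e by (simp add: fs_vector_field_def)
  moreover have "(?Z has_vector_derivative (f (X t) (Y t) e, Y', 0)) (at t)"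
    by (intro has_vector_derivative_Pair X Y has_vector_derivative_const)
  ultimately have "(?Z has_vector_derivative (1 / e) *\<^sub>R ?V (?Z t)) (at t)" by simp
  from vector_derivative_diff_chain_within[OF this has_derivative_at_withinI[OF D]]
  have "((\<lambda>t. ?w (?Z t)) has_vector_derivative (1 / e) *\<^sub>R scaled_time_deriv f g (Suc n) (?Z t)) (at t)"
    by (simp add: o_def scaled_time_deriv_def lie_deriv_def
        linear_scale[OF has_derivative_linear[OF D[unfolded scaled_time_deriv_def]]])
  from has_vector_derivative_scaleR[OF DERIV_const[of "1 / e ^ n"] this]
  have "((\<lambda>t. (1 / e ^ n) *\<^sub>R ?w (?Z t)) has_vector_derivative
      (1 / e ^ Suc n) *\<^sub>R scaled_time_deriv f g (Suc n) (?Z t)) (at t)"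
    by (simp add: mult.commute)
  then have "(((\<lambda>u t. vector_derivative u (at t)) ^^ n) Y has_vector_derivative
      (1 / e ^ Suc n) *\<^sub>R scaled_time_deriv f g (Suc n) (?Z t)) (at t)"
    by (rule has_vector_derivative_transform_within_open[OF _ T Suc.prems]) (simp add: Suc.IH)
  then show ?case by (simp add: vector_derivative_at)
qed

text \<open>The existence theorem is applied to the extended system; its third component has zero velocity,
  so it keeps the value \<open>e\<close> and the other two components solve the original system.\<close>
lemma solution_through_state:
  assumes e: "0 < e" "e < \<epsilon>0"
  obtains \<delta> X Y where "0 < \<delta>" "solves f g e {-\<delta><..<\<delta>} X Y" "X 0 = x" "Y 0 = y"
proof -
  let ?S = "parameter_slab \<epsilon>0 :: ((real^'s) \<times> (real^'f) \<times> real) set"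
  let ?F = "\<lambda>p. (1 / e) *\<^sub>R fs_vector_field f g p"
  have in_slab: "(x, y, e) \<in> ?S" using e by auto
  have "Ck_on 1 ?S ?F"
    using smooth_fs_vector_field unfolding smooth_on_def
    by (intro Ck_on_linear_compose[OF open_slab bounded_linear_scaleR_right]) blast
  then obtain r L where r: "0 < r" "cball (x, y, e) r \<subseteq> ?S"
    and lip: "L-lipschitz_on (cball (x, y, e) r) ?F"
    by (rule Ck_on_locally_lipschitz[OF open_slab in_slab])
  obtain \<delta> u where \<delta>: "0 < \<delta>" and u0: "u 0 = (x, y, e)"
    and u: "\<forall>t. \<bar>t\<bar> < \<delta> \<longrightarrow> (u has_vector_derivative ?F (u t)) (at t)"
    by (rule local_solution_exists[OF r(1) lip])
  define X where "X t = fst (u t)" for t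
  define Y where "Y t = fst (snd (u t))" for t
  define E where "E t = snd (snd (u t))" for t
  have X: "(X has_vector_derivative fst (?F (u t))) (at t)"
    and Y: "(Y has_vector_derivative fst (snd (?F (u t)))) (at t)"
    and E: "(E has_vector_derivative snd (snd (?F (u t)))) (at t)" if "\<bar>t\<bar> < \<delta>" for t
    unfolding X_def Y_def E_def
    by (rule bounded_linear.has_vector_derivative[OF _ u[rule_format, OF that]],
        intro bounded_linear_fst bounded_linear_fst_comp bounded_linear_snd_comp
          bounded_linear_snd bounded_linear_ident)+
  have "(E has_vector_derivative 0) (at t within {-\<delta><..<\<delta>})" if "t \<in> {-\<delta><..<\<delta>}" for t
    using E[of t] that
    by (auto simp: fs_vector_field_def case_prod_beta intro: has_vector_derivative_at_within)
  then obtain c where "\<And>t. t \<in> {-\<delta><..<\<delta>} \<Longrightarrow> E t = c"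
    using has_vector_derivative_zero_constant[of "{-\<delta><..<\<delta>}" E] by auto
  then have E_const: "E t = e" if "t \<in> {-\<delta><..<\<delta>}" for t
  proof -
    have "E t = E 0" using that \<delta> \<open>\<And>t. t \<in> {-\<delta><..<\<delta>} \<Longrightarrow> E t = c\<close> by auto
    then show ?thesis by (simp add: E_def u0)
  qed
  have field: "?F (u t) = (f (X t) (Y t) e, (1 / e) *\<^sub>R g (X t) (Y t) e, 0)"
    if "t \<in> {-\<delta><..<\<delta>}" for t
    using E_const[OF that] e by (simp add: fs_vector_field_def X_def Y_def E_def case_prod_beta)
  have "solves f g e {-\<delta><..<\<delta>} X Y"
    unfolding solves_def
  proof (intro ballI exI conjI)
    fix t assume t: "t \<in> {-\<delta><..<\<delta>}"
    then have "\<bar>t\<bar> < \<delta>" by auto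
    from X[OF this] Y[OF this]
    show "(X has_vector_derivative f (X t) (Y t) e) (at t)"
      "(Y has_vector_derivative (1 / e) *\<^sub>R g (X t) (Y t) e) (at t)"
      by (simp_all only: field[OF t] fst_conv snd_conv)
    show "e *\<^sub>R ((1 / e) *\<^sub>R g (X t) (Y t) e) = g (X t) (Y t) e" using e by simp
  qed
  then show ?thesis by (rule that[OF \<delta>]) (simp_all add: X_def Y_def u0)
qed

lemma time_deriv_eq:
  assumes e: "0 < e" "e < \<epsilon>0"
  shows "time_deriv f g e n x y = (1 / e ^ n) *\<^sub>R scaled_time_deriv f g n (x, y, e)"
  unfolding time_deriv_def
proof (rule the_equality)
  have endpoint: "((\<lambda>u t. vector_derivative u (at t)) ^^ n) Y 0
      = (1 / e ^ n) *\<^sub>R scaled_time_deriv f g n (x, y, e)"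
    if "0 < \<delta>" "solves f g e {-\<delta><..<\<delta>} X Y" "X 0 = x" "Y 0 = y" for \<delta> X Y
    using time_derivs_along_solution[OF e open_greaterThanLessThan that(2), of 0 n] that by simp
  obtain \<delta> X Y where sol: "0 < \<delta>" "solves f g e {-\<delta><..<\<delta>} X Y" "X 0 = x" "Y 0 = y"
    using solution_through_state[OF e] .
  from sol endpoint[OF sol] show "\<exists>\<delta>>0. \<exists>X Y. solves f g e {-\<delta><..<\<delta>} X Y \<and> X 0 = x \<and> Y 0 = y
      \<and> (1 / e ^ n) *\<^sub>R scaled_time_deriv f g n (x, y, e)
        = ((\<lambda>u t. vector_derivative u (at t)) ^^ n) Y 0"
    by metis
  show "v = (1 / e ^ n) *\<^sub>R scaled_time_deriv f g n (x, y, e)"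
    if "\<exists>\<delta>>0. \<exists>X Y. solves f g e {-\<delta><..<\<delta>} X Y \<and> X 0 = x \<and> Y 0 = y
      \<and> v = ((\<lambda>u t. vector_derivative u (at t)) ^^ n) Y 0" for v
    using that endpoint by metis
qed

text \<open>With the step size proportional to \<open>e\<close> all negative powers of \<open>e\<close> cancel.\<close>
lemma iter_map_eq:
  assumes e: "0 < e" "e < \<epsilon>0"
  shows "iter_map f g x0 m e (c * e) y
    = y - (-c) ^ (m + 1) *\<^sub>R scaled_time_deriv f g (m + 1) (x0, y, e)"
proof -
  have "(- (c * e)) ^ (m + 1) = (-c) ^ (m + 1) * e ^ (m + 1)"
    by (simp only: power_mult_distrib[symmetric] mult_minus_left)
  then have "(- (c * e)) ^ (m + 1) * (1 / e ^ (m + 1)) = (-c) ^ (m + 1)"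
    using e by (simp only: times_divide_eq_right mult_1_right) simp
  then show ?thesis
    by (simp only: iter_map_def time_deriv_eq[OF e] scaleR_scaleR)
qed

text \<open>The slow component \<open>e f\<close> is invisible here: its derivative in a direction with no parameter
  component carries the factor \<open>e = 0\<close>.\<close>
lemma fast_deriv_field_at_equilibrium:
  assumes "0 < \<epsilon>0" "g x0 y0 0 = 0"
  shows "frechet_derivative (fs_vector_field f g) (at (x0, y0, 0)) (0, v, 0)
    = (0, D\<^sub>y g x0 y0 0 *v v, 0)"
proof -
  let ?p = "(x0, y0, 0)"
  let ?f = "\<lambda>(x, y, e). f x y e" and ?g = "\<lambda>(x, y, e). g x y e"
  let ?D = "\<lambda>u. frechet_derivative u (at ?p)"
  have p: "?p \<in> parameter_slab \<epsilon>0" using assms(1) by auto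
  note Df = smooth_onD(1)[OF f_smooth p] and Dg = smooth_onD(1)[OF g_smooth p]
  have "((\<lambda>p. (snd (snd p) *\<^sub>R ?f p, ?g p, 0::real)) has_derivative
      (\<lambda>d. (snd (snd ?p) *\<^sub>R ?D ?f d + snd (snd d) *\<^sub>R ?f ?p, ?D ?g d, 0))) (at ?p)"
    by (intro has_derivative_Pair has_derivative_scaleR has_derivative_snd has_derivative_ident
        has_derivative_const Df Dg)
  moreover have "(\<lambda>p. (snd (snd p) *\<^sub>R ?f p, ?g p, 0)) = fs_vector_field f g"
    by (auto simp: fs_vector_field_def fun_eq_iff)
  ultimately have "(\<lambda>d. (snd (snd ?p) *\<^sub>R ?D ?f d + snd (snd d) *\<^sub>R ?f ?p, ?D ?g d, 0))
      = ?D (fs_vector_field f g)"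
    using frechet_derivative_at by fastforce
  from fun_cong[OF this, of "(0, v, 0)"]
  have field: "?D (fs_vector_field f g) (0, v, 0) = (0, ?D ?g (0, v, 0), 0)" by simp
  have "((\<lambda>y. (x0, y, 0::real)) has_derivative (\<lambda>v. (0, v, 0))) (at y0)"
    by (intro has_derivative_Pair has_derivative_ident has_derivative_const)
  from diff_chain_at[OF this Dg]
  have "((\<lambda>y. g x0 y 0) has_derivative (\<lambda>v. ?D ?g (0, v, 0))) (at y0)"
    by (simp add: o_def)
  moreover from this have "((\<lambda>y. g x0 y 0) has_derivative (*v) (D\<^sub>y g x0 y0 0)) (at y0)"
    unfolding D\<^sub>y_def using jacobian_works differentiableI by blast
  ultimately have "?D ?g (0, v, 0) = D\<^sub>y g x0 y0 0 *v v"
    by (metis has_derivative_unique)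
  then show ?thesis using field by simp
qed


text \<open>Each Lie derivative along a field vanishing at the base point composes the differential with that
  of the field, and fast directions are mapped to fast directions by \<open>D\<^sub>y g\<close>.\<close>
lemma fast_deriv_scaled_time_deriv_at_equilibrium:
  assumes "0 < \<epsilon>0" "g x0 y0 0 = 0"
  shows "frechet_derivative (scaled_time_deriv f g n) (at (x0, y0, 0)) (0, v, 0)
    = mat_power (D\<^sub>y g x0 y0 0) n *v v"
proof (induction n arbitrary: v)
  case 0
  have "((\<lambda>p. fst (snd p)) has_derivative (\<lambda>d. fst (snd d))) (at (x0, y0, 0 :: real))"
    by (intro has_derivative_fst has_derivative_snd has_derivative_ident)
  from frechet_derivative_at[OF this, symmetric] show ?case
    by (simp add: scaled_time_deriv_def)
next
  case (Suc n)
  let ?p = "(x0, y0, 0)"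
  have p: "?p \<in> parameter_slab \<epsilon>0" using assms(1) by auto
  have zero: "fs_vector_field f g ?p = 0"
    by (simp add: fs_vector_field_def assms(2) zero_prod_def)
  have "scaled_time_deriv f g (Suc n) = lie_deriv (fs_vector_field f g) (scaled_time_deriv f g n)"
    by (simp add: scaled_time_deriv_def)
  then show ?case
    by (simp add: deriv_lie_deriv_at_zero[OF open_slab p smooth_fs_vector_field
          smooth_scaled_time_deriv zero] fast_deriv_field_at_equilibrium[of x0 y0 v] assms Suc.IH
        matrix_vector_mul_assoc)
qed

text \<open>The Jacobian depends continuously on the extended state \<open>(x, y, e)\<close>, so only its value at
  \<open>(x0, y0, 0)\<close> matters.\<close>
lemma jacobian_iter_map_tendsto:
  assumes "0 < \<epsilon>0" "g x0 y0 0 = 0" and hm: "(hm \<longlongrightarrow> y0) (at_right 0)"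
  shows "((\<lambda>e. jacobian (iter_map f g x0 m e (c * e)) (at (hm e))) \<longlongrightarrow>
    mat 1 - (-c) ^ (m + 1) *\<^sub>R mat_power (D\<^sub>y g x0 y0 0) (m + 1)) (at_right 0)"
proof -
  let ?w = "scaled_time_deriv f g (m + 1)"
  let ?S = "parameter_slab \<epsilon>0 :: ((real^'s) \<times> (real^'f) \<times> real) set"
  define J where "J p = matrix (\<lambda>v. v - (-c) ^ (m + 1) *\<^sub>R frechet_derivative ?w (at p) (0, v, 0))"
    for p
  have J: "jacobian (iter_map f g x0 m e (c * e)) (at y) = J (x0, y, e)"
    if e: "0 < e" "e < \<epsilon>0" for e y
  proof -
    have "(x0, y, e) \<in> ?S" using e by auto
    note D = smooth_onD(1)[OF smooth_scaled_time_deriv[of "m + 1"] this]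
    have "((\<lambda>y. (x0, y, e)) has_derivative (\<lambda>v. (0, v, 0))) (at y)"
      by (intro has_derivative_Pair has_derivative_ident has_derivative_const)
    from diff_chain_at[OF this D]
    have "((\<lambda>y. y - (-c) ^ (m + 1) *\<^sub>R ?w (x0, y, e)) has_derivative
        (\<lambda>v. v - (-c) ^ (m + 1) *\<^sub>R frechet_derivative ?w (at (x0, y, e)) (0, v, 0))) (at y)"
      unfolding o_def
      by (intro has_derivative_diff has_derivative_ident has_derivative_scaleR_right)
    from frechet_derivative_at[OF this]
    show ?thesis
      by (simp only: jacobian_def J_def iter_map_eq[OF e, abs_def])
  qed
  have p0: "(x0, y0, 0) \<in> ?S" using assms(1) by auto
  have "((\<lambda>e. (x0, hm e, e)) \<longlongrightarrow> (x0, y0, 0)) (at_right 0)"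
    by (intro tendsto_Pair tendsto_const hm tendsto_ident_at)
  then have D_lim: "((\<lambda>e. frechet_derivative ?w (at (x0, hm e, e)) d) \<longlongrightarrow>
      frechet_derivative ?w (at (x0, y0, 0)) d) (at_right 0)" for d
  proof (rule isCont_tendsto_compose[rotated])
    have "continuous_on ?S (\<lambda>p. frechet_derivative ?w (at p) d)"
      by (rule smooth_onD(3)[OF smooth_onD(2)[OF smooth_scaled_time_deriv]])
    then show "isCont (\<lambda>p. frechet_derivative ?w (at p) d) (x0, y0, 0)"
      using p0 continuous_on_eq_continuous_at[OF open_slab] by blast
  qed
  have "((\<lambda>e. J (x0, hm e, e)) \<longlongrightarrow> J (x0, y0, 0)) (at_right 0)"
    unfolding J_def matrix_def
    by (intro vec_tendstoI, simp only: vec_lambda_beta)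
      (intro tendsto_vec_nth tendsto_diff tendsto_scaleR tendsto_const D_lim)
  moreover have "J (x0, y0, 0) = mat 1 - (-c) ^ (m + 1) *\<^sub>R mat_power (D\<^sub>y g x0 y0 0) (m + 1)"
  proof -
    have "(\<lambda>v. v - (-c) ^ (m + 1) *\<^sub>R frechet_derivative ?w (at (x0, y0, 0)) (0, v, 0))
      = (*v) (mat 1 - (-c) ^ (m + 1) *\<^sub>R mat_power (D\<^sub>y g x0 y0 0) (m + 1))"
      by (rule ext) (simp only: fast_deriv_scaled_time_deriv_at_equilibrium[OF assms(1,2)]
          matrix_vector_mult_diff_rdistrib matrix_vector_mul_lid flip: scaleR_matrix_vector_assoc)
    then show ?thesis by (simp only: J_def matrix_of_matrix_vector_mul)
  qed
  moreover have "\<forall>\<^sub>F e in at_right 0.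
      J (x0, hm e, e) = jacobian (iter_map f g x0 m e (c * e)) (at (hm e))"
    using eventually_at_right_less[of 0] eventually_at_rightI[of 0 \<epsilon>0 "\<lambda>e. e < \<epsilon>0"] assms(1)
    by (auto elim!: eventually_elim2 simp: J)
  ultimately show ?thesis
    using Lim_transform_eventually by force
qed

end

section \<open>Spectral mapping for a matrix power\<close>

lemma complexified_mat_power:
  fixes A :: "real^'n^'n"
  shows "map_matrix complex_of_real (mat_power A n) = mat_power (map_matrix complex_of_real A) n"
proof (induction n)
  case 0
  show ?case by (simp add: vec_eq_iff mat_def)
next
  case (Suc n)
  have "map_matrix complex_of_real (B ** A) = map_matrix complex_of_real B ** map_matrix complex_of_real A"
    for B :: "real^'n^'n"
    by (simp add: vec_eq_iff matrix_matrix_mult_def)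
  then show ?case by (simp add: Suc.IH)
qed

lemma mat_scalar_vector: "mat c *v v = c *s v"
  by (simp add: vec_eq_iff matrix_vector_mult_def mat_def if_distrib[of "\<lambda>x. x * _"] cong: if_cong)

lemma eigenvalue_iff_det:
  fixes A :: "'a::field^'n^'n"
  shows "(\<exists>v. v \<noteq> 0 \<and> A *v v = \<mu> *s v) \<longleftrightarrow> det (mat \<mu> - A) = 0"
proof -
  have "det (mat \<mu> - A) = 0 \<longleftrightarrow> \<not> (\<exists>B. B ** (mat \<mu> - A) = mat 1)"
    by (metis invertible_det_nz invertible_left_inverse)
  also have "\<dots> \<longleftrightarrow> (\<exists>v. (mat \<mu> - A) *v v = 0 \<and> v \<noteq> 0)"
    unfolding matrix_left_invertible_ker by blast
  also have "\<dots> \<longleftrightarrow> (\<exists>v. v \<noteq> 0 \<and> A *v v = \<mu> *s v)"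
    by (auto simp: matrix_vector_mult_diff_rdistrib mat_scalar_vector eq_commute[of "\<mu> *s _"])
  finally show ?thesis by simp
qed

lemma spectrum_eq_range:
  assumes "eigenvalue_enum A lam"
  shows "spectrum A = range lam"
  using assms unfolding spectrum_def eigenvalue_iff_det eigenvalue_enum_def by auto

lemma mat_power_eigenvector:
  fixes B :: "complex^'n^'n"
  assumes "B *v v = r *s v"
  shows "mat_power B n *v v = r ^ n *s v"
proof (induction n)
  case (Suc n)
  have "mat_power B (Suc n) *v v = mat_power B n *v (r *s v)"
    by (simp add: assms flip: matrix_vector_mul_assoc)
  then show ?case
    by (simp add: vector_scalar_commute vector_smult_assoc Suc.IH)
qed simp

lemma mat_power_commute: "B ** mat_power B n = mat_power B n ** B"
  by (induction n) (simp_all add: matrix_mul_assoc)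

text \<open>The vector \<open>p(B) v\<close>, evaluated by Horner's scheme so that it can be computed by recursion on the
  coefficients.\<close>
definition poly_action :: "complex^'n^'n \<Rightarrow> complex^'n \<Rightarrow> complex poly \<Rightarrow> complex^'n" where
  "poly_action B v p = fold_coeffs (\<lambda>a u. a *s v + B *v u) p 0"

lemma poly_action_0 [simp]: "poly_action B v 0 = 0"
  by (simp add: poly_action_def)

lemma poly_action_pCons [simp]: "poly_action B v (pCons a p) = a *s v + B *v poly_action B v p"
  by (cases "a = 0 \<and> p = 0") (auto simp: poly_action_def)

lemma poly_action_add: "poly_action B v (p + q) = poly_action B v p + poly_action B v q"
  by (induction p q rule: poly_induct2)
    (simp_all add: vector_sadd_rdistrib vec.add algebra_simps)

lemma poly_action_smult: "poly_action B v (smult c p) = c *s poly_action B v p"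
  by (induction p)
    (simp_all add: vector_add_ldistrib vector_smult_assoc vector_scalar_commute)

lemma poly_action_monom: "poly_action B v (monom c n) = c *s (mat_power B n *v v)"
proof (induction n)
  case 0
  show ?case by (simp add: monom_0)
next
  case (Suc n)
  then show ?case
    by (simp add: monom_Suc vector_scalar_commute matrix_vector_mul_assoc mat_power_commute)
qed

text \<open>Take a root \<open>r\<close> of \<open>p\<close> and write \<open>p = (z - r) q\<close>. Then \<open>(B - r) q(B) v = 0\<close>, so either
  \<open>q(B) v\<close> is an eigenvector for \<open>r\<close>, or it vanishes and \<open>q\<close> has smaller degree.\<close>
lemma root_is_eigenvalue:
  assumes "p \<noteq> 0" "v \<noteq> 0" "poly_action B v p = 0"
  shows "\<exists>r u. poly p r = 0 \<and> u \<noteq> 0 \<and> B *v u = r *s u"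
  using assms(1,3)
proof (induction "degree p" arbitrary: p)
  case 0
  then obtain a where "p = [:a:]" using degree_eq_zeroE by metis
  with 0 assms(2) show ?case by simp
next
  case (Suc n)
  have "\<not> constant (poly p)" using Suc.hyps(2) by (simp add: constant_degree)
  then obtain r where r: "poly p r = 0"
    using fundamental_theorem_of_algebra by blast
  then obtain q where p: "p = [:-r, 1:] * q"
    using poly_eq_0_iff_dvd by (metis dvd_def)
  have "q \<noteq> 0" using Suc.prems(1) p by auto
  then have "degree p = degree [:-r, 1:] + degree q"
    unfolding p by (intro degree_mult_eq) auto
  then have deg: "n = degree q"
    using Suc.hyps(2) by simp
  have "p = smult (-r) q + pCons 0 q" using p by simp
  then have "poly_action B v p = (-r) *s poly_action B v q + B *v poly_action B v q"
    by (simp only: poly_action_add poly_action_smult poly_action_pCons) simp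
  then have eq: "B *v poly_action B v q = r *s poly_action B v q"
    using Suc.prems(2) by (simp add: add_eq_0_iff)
  show ?case
  proof (cases "poly_action B v q = 0")
    case True
    then show ?thesis using Suc.hyps(1)[OF deg \<open>q \<noteq> 0\<close>] p by auto
  next
    case False
    then show ?thesis using eq r by blast
  qed
qed

text \<open>The vector \<open>v\<close> itself need not be an eigenvector of \<open>B\<close>; the previous lemma for \<open>z\<^sup>n - w\<close> provides
  one.\<close>
lemma mat_power_eigenvalue:
  fixes B :: "complex^'n^'n"
  assumes "v \<noteq> 0" "mat_power B n *v v = w *s v" "0 < n"
  obtains r u where "r ^ n = w" "u \<noteq> 0" "B *v u = r *s u"
proof -
  let ?p = "monom 1 n + [:-w:] :: complex poly"
  have "coeff ?p n = 1" using assms(3) by (cases n) auto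
  then have "?p \<noteq> 0" by (metis coeff_0 zero_neq_one)
  moreover have "poly_action B v ?p = 0"
    by (simp only: poly_action_add poly_action_monom) (simp add: assms(2))
  ultimately obtain r u where "poly ?p r = 0" "u \<noteq> 0" "B *v u = r *s u"
    using root_is_eigenvalue[OF _ assms(1)] by blast
  then show ?thesis using that by (simp add: poly_monom)
qed

lemma spectrum_one_minus_power:
  fixes A :: "real^'n^'n"
  assumes n: "0 < n" and k: "k \<noteq> 0"
  shows "spectrum (mat 1 - k ^ n *\<^sub>R mat_power A n)
    = (\<lambda>\<mu>. 1 - (of_real k * \<mu>) ^ n) ` spectrum A"
proof -
  let ?C = "map_matrix complex_of_real"
  let ?J = "mat 1 - k ^ n *\<^sub>R mat_power A n" and ?P = "mat_power (?C A) n"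
  have "?C ?J = mat 1 - mat (of_real (k ^ n)) ** ?C (mat_power A n)"
    by (simp add: vec_eq_iff matrix_matrix_mult_def mat_def if_distrib[of "\<lambda>x. x * _"] cong: if_cong)
  then have J: "?C ?J *v v = v - of_real (k ^ n) *s (?P *v v)" for v
    by (simp only: complexified_mat_power matrix_vector_mult_diff_rdistrib matrix_vector_mul_lid
        mat_scalar_vector vector_smult_lid flip: matrix_vector_mul_assoc)
  show ?thesis
  proof (intro equalityI subsetI)
    fix z assume "z \<in> (\<lambda>\<mu>. 1 - (of_real k * \<mu>) ^ n) ` spectrum A"
    then obtain \<mu> v where z: "z = 1 - (of_real k * \<mu>) ^ n" and v: "v \<noteq> 0" "?C A *v v = \<mu> *s v"
      by (auto simp: spectrum_def)
    have "?C ?J *v v = z *s v"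
      by (simp add: J z mat_power_eigenvector[OF v(2)] vector_smult_assoc power_mult_distrib
          vector_sub_rdistrib)
    with v(1) show "z \<in> spectrum ?J" by (auto simp: spectrum_def)
  next
    fix z assume "z \<in> spectrum ?J"
    then obtain v where v: "v \<noteq> 0" "v - of_real (k ^ n) *s (?P *v v) = z *s v"
      by (auto simp: spectrum_def J simp del: of_real_power)
    let ?w = "(1 - z) / of_real (k ^ n)"
    have "?P *v v = ?w *s v"
    proof -
      have "of_real (k ^ n) *s (?P *v v) = (1 - z) *s v"
        using v(2) by (simp add: vector_sub_rdistrib algebra_simps)
      then have "(1 / of_real (k ^ n)) *s (of_real (k ^ n) *s (?P *v v)) = ?w *s v"
        by (simp add: vector_smult_assoc diff_divide_distrib)
      then show ?thesis using k by (simp add: vector_smult_assoc)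
    qed
    then obtain r u where "r ^ n = ?w" and u: "u \<noteq> 0" "?C A *v u = r *s u"
      by (rule mat_power_eigenvalue[OF v(1) _ n])
    then have "z = 1 - (of_real k * r) ^ n"
      using k by (simp add: power_mult_distrib)
    moreover have "r \<in> spectrum A" using u by (auto simp: spectrum_def)
    ultimately show "z \<in> (\<lambda>\<mu>. 1 - (of_real k * \<mu>) ^ n) ` spectrum A" by blast
  qed
qed

text \<open>For a real eigenvalue, the real and imaginary parts of a complex eigenvector satisfy the eigenvalue
  equation separately, and one of them is nonzero.\<close>
lemma real_eigenvalue_le_onorm:
  fixes A :: "real^'n^'n"
  assumes "\<mu> \<in> spectrum A" "\<mu> \<in> \<real>"
  shows "cmod \<mu> \<le> onorm ((*v) A)"
proof -
  obtain r where r: "\<mu> = of_real r" using assms(2) Reals_cases by blast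
  obtain v where v: "v \<noteq> 0" "map_matrix complex_of_real A *v v = \<mu> *s v"
    using assms(1) by (auto simp: spectrum_def)
  have "\<bar>r\<bar> * norm u \<le> onorm ((*v) A) * norm u" if "A *v u = r *\<^sub>R u" for u
    using onorm[OF matrix_vector_mul_bounded_linear[of A], of u] that by simp
  moreover have "A *v (\<chi> i. Re (v $ i)) = r *\<^sub>R (\<chi> i. Re (v $ i))"
    "A *v (\<chi> i. Im (v $ i)) = r *\<^sub>R (\<chi> i. Im (v $ i))"
  proof -
    have "(\<Sum>j\<in>UNIV. of_real (A $ i $ j) * v $ j) = of_real r * v $ i" for i
      using arg_cong[OF v(2), of "\<lambda>x. x $ i"] by (simp add: matrix_vector_mult_def r)
    from arg_cong[OF this, of Re] arg_cong[OF this, of Im]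
    show "A *v (\<chi> i. Re (v $ i)) = r *\<^sub>R (\<chi> i. Re (v $ i))"
      "A *v (\<chi> i. Im (v $ i)) = r *\<^sub>R (\<chi> i. Im (v $ i))"
      by (simp_all add: vec_eq_iff matrix_vector_mult_def)
  qed
  moreover have "(\<chi> i. Re (v $ i)) \<noteq> 0 \<or> (\<chi> i. Im (v $ i)) \<noteq> 0"
    using v(1) by (auto simp: vec_eq_iff complex_eq_iff)
  ultimately have "\<bar>r\<bar> \<le> onorm ((*v) A)"
    by (metis mult_le_cancel_right_pos zero_less_norm_iff)
  then show ?thesis by (simp add: r)
qed

section \<open>Eigenvalues in the unit disk\<close>

text \<open>Multiplied by \<open>m + 1\<close> and centred at \<open>\<pi>\<close>, the \<open>k\<close>-th arc becomes the interval of radius \<open>\<pi>/2\<close>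
  around \<open>2 \<pi> k\<close>, and a turn of \<open>\<theta>\<close> by \<open>2 \<pi>\<close> shifts the index by \<open>m + 1\<close>. The residues
  \<open>k = 0, \<dots>, m\<close> thus account for all intervals on which the cosine is positive.\<close>
lemma mem_S_arcs_iff:
  assumes "pi / 2 < \<theta>" "\<theta> < 3 * pi / 2"
  shows "\<theta> \<in> S_arcs m \<longleftrightarrow> 0 < cos ((real m + 1) * (\<theta> - pi))"
proof -
  let ?M = "real m + 1"
  define \<phi> where "\<phi> = ?M * (\<theta> - pi)"
  have M: "0 < ?M" by simp
  have \<theta>: "\<theta> = pi + \<phi> / ?M" by (simp add: \<phi>_def)
  have arc: "\<theta> + 2 * pi * of_int j \<in> {(2 * real m + 4 * real k + 1) / (2 * ?M) * pi <..<
      (2 * real m + 4 * real k + 3) / (2 * ?M) * pi}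
    \<longleftrightarrow> \<bar>\<phi> + 2 * pi * of_int (j * (int m + 1) - int k)\<bar> < pi / 2" for j :: int and k :: nat
  proof -
    let ?D = "\<phi> + 2 * pi * of_int (j * (int m + 1) - int k)"
    have "\<theta> + 2 * pi * of_int j = (2 * ?D + (2 * real m + 4 * real k + 2) * pi) / (2 * ?M)"
      using M by (simp add: \<theta> field_simps)
    moreover have "a / (2 * ?M) * pi = (a * pi) / (2 * ?M)" for a by simp
    ultimately have "\<theta> + 2 * pi * of_int j \<in> {(2 * real m + 4 * real k + 1) / (2 * ?M) * pi <..<
        (2 * real m + 4 * real k + 3) / (2 * ?M) * pi}
      \<longleftrightarrow> (2 * real m + 4 * real k + 2) * pi - pi < 2 * ?D + (2 * real m + 4 * real k + 2) * pi \<and>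
        2 * ?D + (2 * real m + 4 * real k + 2) * pi < (2 * real m + 4 * real k + 2) * pi + pi"
      using M by (simp only: greaterThanLessThan_iff divide_less_cancel) (simp add: distrib_right)
    also have "\<dots> \<longleftrightarrow> \<bar>?D\<bar> < pi / 2"
    proof -
      have "a - p < 2 * d + a \<and> 2 * d + a < a + p \<longleftrightarrow> \<bar>d\<bar> < p / 2" for a p d :: real
        by linarith
      then show ?thesis .
    qed
    finally show ?thesis .
  qed
  have "\<theta> \<in> S_arcs m \<longleftrightarrow> (\<exists>j. \<exists>k\<in>{0..m}. \<bar>\<phi> + 2 * pi * of_int (j * (int m + 1) - int k)\<bar> < pi / 2)"
  proof -
    have "\<theta> + 2 * pi * of_int 0 \<in> {pi / 2 <..< 3 * pi / 2}" using assms by simp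
    then have "\<theta> \<in> mod_2pi {pi / 2 <..< 3 * pi / 2}"
      unfolding mod_2pi_def by blast
    then show ?thesis unfolding S_arcs_def arc[symmetric] by (simp only: mod_2pi_def) blast
  qed
  also have "\<dots> \<longleftrightarrow> (\<exists>i::int. \<bar>\<phi> + 2 * pi * of_int i\<bar> < pi / 2)"
  proof -
    have "\<exists>j. \<exists>k\<in>{0..m}. i = j * (int m + 1) - int k" for i :: int
    proof -
      \<comment> \<open>division with remainder, applied to \<open>-i\<close> because \<open>k\<close> enters with a minus sign\<close>
      let ?k = "nat ((- i) mod (int m + 1))"
      have "i = (- ((- i) div (int m + 1))) * (int m + 1) - int ?k"
        using div_mult_mod_eq[of "-i" "int m + 1"] by simp
      moreover have "?k \<in> {0..m}"
        using pos_mod_bound[of "int m + 1" "-i"] by (simp add: nat_le_iff)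
      ultimately show ?thesis by blast
    qed
    then show ?thesis by metis
  qed
  also have "\<dots> \<longleftrightarrow> 0 < cos \<phi>"
  proof -
    have shift: "cos (\<phi> + 2 * pi * of_int i) = cos \<phi>" for i :: int by (simp add: cos_add)
    show ?thesis
    proof
    assume "\<exists>i::int. \<bar>\<phi> + 2 * pi * of_int i\<bar> < pi / 2"
    then obtain i :: int where "\<bar>\<phi> + 2 * pi * of_int i\<bar> < pi / 2" ..
    then have "0 < cos (\<phi> + 2 * pi * of_int i)"
      by (intro cos_gt_zero_pi) linarith+
    then show "0 < cos \<phi>" unfolding shift .
  next
    assume pos: "0 < cos \<phi>"
    \<comment> \<open>subtracting the nearest multiple of \<open>2 \<pi>\<close> moves \<open>\<phi>\<close> into \<open>[-\<pi>, \<pi>]\<close>\<close>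
    let ?i = "- round (\<phi> / (2 * pi))"
    let ?\<psi> = "\<phi> + 2 * pi * of_int ?i"
    have "\<bar>of_int (round (\<phi> / (2 * pi))) - \<phi> / (2 * pi)\<bar> \<le> 1 / 2"
      by (rule of_int_round_abs_le)
    then have le: "\<bar>?\<psi>\<bar> \<le> pi"
      by (simp add: abs_le_iff field_simps)
    have "0 < cos \<bar>?\<psi>\<bar>" using pos unfolding cos_abs_real shift .
    have "\<bar>?\<psi>\<bar> < pi / 2"
    proof (rule ccontr)
      assume "\<not> \<bar>?\<psi>\<bar> < pi / 2"
      then have "cos \<bar>?\<psi>\<bar> \<le> cos (pi / 2)"
        using le pi_gt_zero by (intro cos_monotone_0_pi_le) linarith+
      with \<open>0 < cos \<bar>?\<psi>\<bar>\<close> show False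
        using cos_pi_half by linarith
    qed
    then show "\<exists>i::int. \<bar>\<phi> + 2 * pi * of_int i\<bar> < pi / 2" by blast
    qed
  qed
  finally show ?thesis by (simp add: \<phi>_def)
qed

text \<open>The squared modulus exceeds 1 by \<open>\<rho> (\<rho> - 2 cos \<phi>)\<close>.\<close>
lemma cmod_one_minus_cis_less_one_iff:
  assumes "0 < \<rho>"
  shows "cmod (1 - of_real \<rho> * cis \<phi>) < 1 \<longleftrightarrow> \<rho> < 2 * cos \<phi>"
proof -
  have "(cmod (1 - of_real \<rho> * cis \<phi>))\<^sup>2 = (1 - \<rho> * cos \<phi>)\<^sup>2 + (\<rho> * sin \<phi>)\<^sup>2"
    by (simp add: cmod_power2)
  also have "\<dots> = 1 - 2 * \<rho> * cos \<phi> + \<rho>\<^sup>2 * ((sin \<phi>)\<^sup>2 + (cos \<phi>)\<^sup>2)"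
    by algebra
  also have "\<dots> = 1 + \<rho> * (\<rho> - 2 * cos \<phi>)"
    by (simp only: sin_cos_squared_add) algebra
  finally have "(cmod (1 - of_real \<rho> * cis \<phi>))\<^sup>2 < 1\<^sup>2 \<longleftrightarrow> \<rho> * (\<rho> - 2 * cos \<phi>) < 0"
    by simp
  also have "\<dots> \<longleftrightarrow> \<rho> < 2 * cos \<phi>"
    using assms by (simp add: mult_less_0_iff)
  finally show ?thesis
    by (simp add: power_less_one_iff abs_square_less_1)
qed

lemma leading_eigenvalue_in_disk_iff:
  assumes "0 < \<epsilon>" "0 < H" "\<mu> \<noteq> 0" and polar: "\<mu> = of_real (cmod \<mu>) * cis \<theta>"
    and \<theta>: "pi / 2 < \<theta>" "\<theta> < 3 * pi / 2"
  shows "cmod (1 - (- of_real (H / \<epsilon>) * \<mu>) ^ (m + 1)) < 1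
    \<longleftrightarrow> \<theta> \<in> S_arcs m \<and> H < H_max m \<epsilon> \<mu> \<theta>"
proof -
  let ?\<rho> = "H / \<epsilon> * cmod \<mu>" and ?c = "2 * cos ((real m + 1) * (\<theta> - pi))"
  have \<rho>: "0 < ?\<rho>" using assms by simp
  have "- cis \<theta> = cis (\<theta> - pi)" by (simp add: complex_eq_iff)
  then have "- of_real (H / \<epsilon>) * \<mu> = of_real ?\<rho> * cis (\<theta> - pi)"
    by (subst polar) (simp flip: \<open>- cis \<theta> = cis (\<theta> - pi)\<close>)
  moreover have "cis (\<theta> - pi) ^ (m + 1) = cis ((real m + 1) * (\<theta> - pi))"
    by (subst Complex.DeMoivre) (simp add: add.commute)
  ultimately have "(- of_real (H / \<epsilon>) * \<mu>) ^ (m + 1) = of_real (?\<rho> ^ (m + 1)) * cis ((real m + 1) * (\<theta> - pi))"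
    by (simp only: power_mult_distrib of_real_power of_real_mult)
  then have "cmod (1 - (- of_real (H / \<epsilon>) * \<mu>) ^ (m + 1)) < 1 \<longleftrightarrow> ?\<rho> ^ (m + 1) < ?c"
    by (simp only: cmod_one_minus_cis_less_one_iff[OF zero_less_power[OF \<rho>]])
  \<comment> \<open>The bound forces the cosine to be positive; stating this separately splits off the condition on
    the angle.\<close>
  also have "\<dots> \<longleftrightarrow> 0 < ?c \<and> ?\<rho> ^ (m + 1) < ?c"
    using zero_less_power[OF \<rho>, of "m + 1"] by linarith
  also have "?\<rho> ^ (m + 1) < ?c \<longleftrightarrow> ?\<rho> < root (m + 1) ?c"
  proof -
    have "root (m + 1) (?\<rho> ^ (m + 1)) = ?\<rho>"
      using \<rho> by (intro real_root_power_cancel) auto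
    then show ?thesis using real_root_less_iff[of "m + 1" "?\<rho> ^ (m + 1)" ?c] by (simp only:)
  qed
  also have "\<dots> \<longleftrightarrow> H < H_max m \<epsilon> \<mu> \<theta>"
    using assms(1,3) by (simp add: H_max_def field_simps)
  finally show ?thesis
    using mem_S_arcs_iff[OF \<theta>] by simp
qed

section \<open>The stability criterion\<close>

theorem theorem3p1:
  fixes f :: "real^'s \<Rightarrow> real^'f \<Rightarrow> real \<Rightarrow> real^'s"
    and g :: "real^'s \<Rightarrow> real^'f \<Rightarrow> real \<Rightarrow> real^'f"
    and K :: "(real^'s) set" and x0 :: "real^'s"
    and h :: "real \<Rightarrow> real^'s \<Rightarrow> real^'f" and hs :: "nat \<Rightarrow> real^'s \<Rightarrow> real^'f"
    and hm :: "real \<Rightarrow> real^'f"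
    and lam :: "'f \<Rightarrow> complex" and \<theta> :: "'f \<Rightarrow> real"
    and \<epsilon>0 \<epsilon> :: real and m :: nat
  assumes eps: "0 < \<epsilon>" "\<epsilon> < \<epsilon>0"
    and f_smooth: "smooth_on (UNIV \<times> UNIV \<times> {-\<epsilon>0<..<\<epsilon>0}) (\<lambda>(x, y, e). f x y e)"
    and g_smooth: "smooth_on (UNIV \<times> UNIV \<times> {-\<epsilon>0<..<\<epsilon>0}) (\<lambda>(x, y, e). g x y e)"
    and nondegenerate: "\<And>x y. g x y 0 = 0 \<Longrightarrow> det (D\<^sub>y g x y 0) \<noteq> 0"
    and manifold: "slow_manifold f g \<epsilon>0 K h hs"
    and x0: "x0 \<in> K"
    and fixed_point: "is_fixed_point_branch f g x0 (hs 0 x0) m hm"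
    and eigenvalues: "eigenvalue_enum (D\<^sub>y g x0 (hs 0 x0) 0) lam"
    and polar: "\<And>l. lam l = of_real (cmod (lam l)) * cis (\<theta> l)"
    and arguments: "\<And>l. pi / 2 < \<theta> l \<and> \<theta> l < 3 * pi / 2"
  shows "(\<forall>H>0. scheme_stable f g x0 m hm \<epsilon> H \<longleftrightarrow>
            (\<forall>l. \<theta> l \<in> S_arcs m \<and> 0 < H \<and> H < H_max m \<epsilon> (lam l) (\<theta> l))) \<and>
         ((\<forall>l. lam l \<in> \<real>) \<longrightarrow>
            (\<forall>H>0. H < root (m + 1) 2 * (\<epsilon> / onorm (\<lambda>v. D\<^sub>y g x0 (hs 0 x0) 0 *v v)) \<longrightarrow>
               scheme_stable f g x0 m hm \<epsilon> H))"
proof -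
  let ?y0 = "hs 0 x0"
  let ?A = "D\<^sub>y g x0 ?y0 0"
  have \<epsilon>0: "0 < \<epsilon>0" using eps by simp
  have equilibrium: "g x0 ?y0 0 = 0" and spec: "\<And>\<mu>. \<mu> \<in> spectrum ?A \<Longrightarrow> Re \<mu> < 0"
    using manifold x0 unfolding slow_manifold_def by blast+
  have lam_in: "lam l \<in> spectrum ?A" for l
    using spectrum_eq_range[OF eigenvalues] by simp
  have lam_nz: "lam l \<noteq> 0" for l using spec[OF lam_in[of l]] by auto
  have hm: "(hm \<longlongrightarrow> ?y0) (at_right 0)"
  proof -
    have "(\<lambda>e. norm (hm e - ?y0)) \<in> O[at_right 0](\<lambda>e. e)"
      using fixed_point unfolding is_fixed_point_branch_def by blast
    then obtain C where "\<forall>\<^sub>F e in at_right 0. norm (norm (hm e - ?y0)) \<le> C * norm e"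
      using landau_o.bigE by blast
    then have "\<forall>\<^sub>F e in at_right 0. norm (hm e - ?y0) \<le> C * norm e" by simp
    moreover have "((\<lambda>e::real. C * norm e) \<longlongrightarrow> 0) (at_right 0)"
      by (auto intro!: tendsto_eq_intros)
    ultimately have "((\<lambda>e. hm e - ?y0) \<longlongrightarrow> 0) (at_right 0)"
      by (rule Lim_null_comparison)
    then show ?thesis by (simp add: LIM_zero_iff)
  qed
  have stable_iff: "scheme_stable f g x0 m hm \<epsilon> H
      \<longleftrightarrow> (\<forall>l. \<theta> l \<in> S_arcs m \<and> H < H_max m \<epsilon> (lam l) (\<theta> l))" if H: "0 < H" for H
  proof -
    let ?c = "H / \<epsilon>"
    let ?J = "mat 1 - (-?c) ^ (m + 1) *\<^sub>R mat_power ?A (m + 1)"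
    note lim = jacobian_iter_map_tendsto[OF f_smooth g_smooth \<epsilon>0 equilibrium hm, of m ?c]
    have "scheme_stable f g x0 m hm \<epsilon> H \<longleftrightarrow> spectrum ?J \<subseteq> ball 0 1"
      unfolding scheme_stable_def
      using lim tendsto_unique[OF trivial_limit_at_right_real _ lim] by blast
    also have "spectrum ?J = (\<lambda>\<mu>. 1 - (of_real (-?c) * \<mu>) ^ (m + 1)) ` range lam"
      using H eps
      by (simp only: spectrum_eq_range[OF eigenvalues, symmetric])
        (intro spectrum_one_minus_power, auto)
    also have "\<dots> \<subseteq> ball 0 1 \<longleftrightarrow> (\<forall>l. cmod (1 - (- of_real ?c * lam l) ^ (m + 1)) < 1)"
      by (simp only: image_image image_subset_iff mem_ball_0 of_real_minus) blast
    also have "\<dots> \<longleftrightarrow> (\<forall>l. \<theta> l \<in> S_arcs m \<and> H < H_max m \<epsilon> (lam l) (\<theta> l))"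
      using leading_eigenvalue_in_disk_iff[OF eps(1) H lam_nz polar] arguments by blast
    finally show ?thesis .
  qed
  have "scheme_stable f g x0 m hm \<epsilon> H"
    if real: "\<forall>l. lam l \<in> \<real>" and H: "0 < H" "H < root (m + 1) 2 * (\<epsilon> / onorm ((*v) ?A))" for H
    unfolding stable_iff[OF H(1)]
  proof
    fix l
    have "cmod (lam l) * sin (\<theta> l) = 0"
      using real arg_cong[OF polar[of l], of Im] by (simp add: complex_is_Real_iff)
    then have "sin (\<theta> l - pi) = 0" using lam_nz by (simp add: sin_diff)
    then have \<theta>: "\<theta> l = pi"
      using arguments[of l] sin_gt_zero[of "\<theta> l - pi"] sin_gt_zero[of "pi - \<theta> l"]
        sin_minus[of "\<theta> l - pi"] by force
    have "\<theta> l \<in> S_arcs m"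
      using mem_S_arcs_iff[of "\<theta> l" m] arguments[of l] by (simp add: \<theta>)
    moreover have "H < H_max m \<epsilon> (lam l) (\<theta> l)"
    proof -
      have "cmod (lam l) \<le> onorm ((*v) ?A)"
        using real real_eigenvalue_le_onorm[OF lam_in] by blast
      moreover from this have "0 < onorm ((*v) ?A)"
        using lam_nz[of l] by (meson less_le_trans zero_less_norm_iff)
      ultimately have "root (m + 1) 2 * (\<epsilon> / onorm ((*v) ?A)) \<le> root (m + 1) 2 * (\<epsilon> / cmod (lam l))"
        using eps(1) lam_nz[of l] by (intro mult_left_mono divide_left_mono mult_pos_pos) auto
      with H(2) show ?thesis by (simp add: H_max_def \<theta> mult.commute)
    qed
    ultimately show "\<theta> l \<in> S_arcs m \<and> H < H_max m \<epsilon> (lam l) (\<theta> l)" ..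
  qed
  with stable_iff show ?thesis by auto
qed

end
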